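(* Let $(X,d)$ be a metric space equipped with a scaling $T$ and a scaling-consistent ideal $\mathcal{S}$ such that, for each $A\in\mathcal{S}$, the ideal $\mathcal{S}$ contains the envelope $A^r=\{x:d(x,A)\le r\}$ for some $r>0$. Let $\xi$ be a random element in $X$, let $(\eta_\gamma)_{\gamma\in\Gamma}$ be a net of random elements in $X$ (defined on the same probability space as $\xi$), let $g:[0,\infty)\to[0,\infty)$ be measurable, and let $\mu\in M(\mathcal{S})$ be non-trivial on $\mathcal{S}$. Then $\xi\in\mathrm{RV}(X,T,\mathcal{S},g,\mu)$ provided the following conditions hold. (i) $\eta_\gamma\in\mathrm{RV}(X,T,\mathcal{S},g,\mu_\gamma)$ for some $\mu_\gamma\in M(\mathcal{S})$, for all $\gamma\in\Gamma$. (ii) $\mu_\gamma\to\mu$ vaguely on $\mathcal{S}$. (iii) For every closed $A\in\mathcal{S}$, $\limsup_{t\to\infty}g(t)\mathbf{P}\{T_{t^{-1}}\xi\in A\}<\infty$. (iv) For all $\delta>0$, $\lim_\gamma\limsup_{t\to\infty}g(t)\mathbf{P}\{d(T_{t^{-1}}\xi,T_{t^{-1}}\eta_\gamma)>\delta\}=0$.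
   Context: A scaling is a family of maps $T_t:X\to X$, $t>0$, with $T_tT_s=T_{ts}$, $T_1=\mathrm{id}$ and $(x,t)\mapsto T_tx$ Borel measurable. An ideal $\mathcal{S}$ is a family of subsets of $X$ closed under finite unions and taking subsets; $U_{\mathcal{S}}$ denotes its union; it is scaling consistent if $T_tB\in\mathcal{S}$ for all $B\in\mathcal{S}$, $t>0$. $M(\mathcal{S})$ is the family of Borel measures on $X$ that are finite on each Borel set in $\mathcal{S}$ and vanish outside $U_{\mathcal{S}}$; $\mu$ is non-trivial if $\mu(B)>0$ for some $B\in\mathcal{S}$. $C(X,\mathcal{S})$ is the family of bounded continuous $f:U_{\mathcal{S}}\to\mathbb{R}$ whose support (closure in $X$ of $\{f\neq0\}$) belongs to $\mathcal{S}$, extended by zero. A net $\mu_\gamma$ converges vaguely to $\mu$ on $\mathcal{S}$ if $\int f\,d\mu_\gamma\to\int f\,d\mu$ for all $f\in C(X,\mathcal{S})$. $\xi\in\mathrm{RV}(X,T,\mathcal{S},g,\mu)$ means that $g$ is measurable, $g(t)\to\infty$ as $t\to\infty$, $\mu\in M(\mathcal{S})$ is non-trivial, and $g(t)\mathbf{E}f(T_{t^{-1}}\xi)\to\int f\,d\mu$ as $t\to\infty$ for all $f\in C(X,\mathcal{S})$. *)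

theory Defs
  imports "HOL-Probability.Probability"
begin

definition scaling :: "(real \<Rightarrow> 'a::metric_space \<Rightarrow> 'a) \<Rightarrow> bool" where
  "scaling T \<longleftrightarrow>
     (\<forall>t>0. \<forall>s>0. \<forall>x. T t (T s x) = T (t * s) x) \<and>
     (\<forall>x. T 1 x = x) \<and>
     (\<lambda>(x, t). T t x) \<in> borel_measurable (restrict_space borel (UNIV \<times> {0<..}))"

definition set_ideal :: "'a set set \<Rightarrow> bool" where
  "set_ideal \<S> \<longleftrightarrow>
     (\<forall>F. finite F \<and> F \<subseteq> \<S> \<longrightarrow> \<Union>F \<in> \<S>) \<and>
     (\<forall>A\<in>\<S>. \<forall>B. B \<subseteq> A \<longrightarrow> B \<in> \<S>)"

definition scaling_consistent :: "(real \<Rightarrow> 'a \<Rightarrow> 'a) \<Rightarrow> 'a set set \<Rightarrow> bool" where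
  "scaling_consistent T \<S> \<longleftrightarrow> (\<forall>B\<in>\<S>. \<forall>t>0. T t ` B \<in> \<S>)"

text \<open>The distance to the empty set is infinite, so the envelope of the empty set is empty;
  the library's \<^const>\<open>infdist\<close> is 0 there, hence the guard.\<close>

definition envelope :: "'a::metric_space set \<Rightarrow> real \<Rightarrow> 'a set" where
  "envelope A r = {x. A \<noteq> {} \<and> infdist x A \<le> r}"

text \<open>The union of an ideal need not be a Borel set; a Borel measure vanishes outside it
  if it assigns measure 0 to every Borel set disjoint from it.\<close>

definition ideal_measures :: "'a::metric_space set set \<Rightarrow> 'a measure set" where
  "ideal_measures \<S> = {\<nu>. sets \<nu> = sets borel \<and>
     (\<forall>B\<in>\<S> \<inter> sets borel. emeasure \<nu> B < \<infinity>) \<and>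
     (\<forall>B\<in>sets borel. B \<inter> \<Union>\<S> = {} \<longrightarrow> emeasure \<nu> B = 0)}"

definition nontrivial_on :: "'a::metric_space set set \<Rightarrow> 'a measure \<Rightarrow> bool" where
  "nontrivial_on \<S> \<nu> \<longleftrightarrow> (\<exists>B\<in>\<S> \<inter> sets borel. emeasure \<nu> B > 0)"

text \<open>Functions on the union of the ideal are represented by their extensions by zero.\<close>

definition test_functions :: "'a::metric_space set set \<Rightarrow> ('a \<Rightarrow> real) set" where
  "test_functions \<S> = {f. continuous_on (\<Union>\<S>) f \<and> bounded (f ` \<Union>\<S>) \<and>
     (\<forall>x. x \<notin> \<Union>\<S> \<longrightarrow> f x = 0) \<and> closure {x. f x \<noteq> 0} \<in> \<S>}"

definition directed_set :: "'i set \<Rightarrow> ('i \<Rightarrow> 'i \<Rightarrow> bool) \<Rightarrow> bool" where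
  "directed_set \<Gamma> le \<longleftrightarrow> \<Gamma> \<noteq> {} \<and>
     (\<forall>i\<in>\<Gamma>. le i i) \<and>
     (\<forall>i\<in>\<Gamma>. \<forall>j\<in>\<Gamma>. \<forall>k\<in>\<Gamma>. le i j \<longrightarrow> le j k \<longrightarrow> le i k) \<and>
     (\<forall>i\<in>\<Gamma>. \<forall>j\<in>\<Gamma>. \<exists>k\<in>\<Gamma>. le i k \<and> le j k)"

text \<open>The filter of tails of a directed index set: a net \<open>x\<close> indexed by it converges to \<open>l\<close>
  iff \<open>x\<close> tends to \<open>l\<close> along this filter.\<close>

definition net_filter :: "'i set \<Rightarrow> ('i \<Rightarrow> 'i \<Rightarrow> bool) \<Rightarrow> 'i filter" where
  "net_filter \<Gamma> le = (INF i\<in>\<Gamma>. principal {j\<in>\<Gamma>. le i j})"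

lemma eventually_net_filter:
  assumes "directed_set \<Gamma> le"
  shows "eventually P (net_filter \<Gamma> le) \<longleftrightarrow> (\<exists>i\<in>\<Gamma>. \<forall>j\<in>\<Gamma>. le i j \<longrightarrow> P j)"
proof -
  have "eventually P (net_filter \<Gamma> le) \<longleftrightarrow>
      (\<exists>i\<in>\<Gamma>. eventually P (principal {j\<in>\<Gamma>. le i j}))"
    unfolding net_filter_def
  proof (rule eventually_INF_base)
    show "\<Gamma> \<noteq> {}"
      using assms by (simp add: directed_set_def)
    fix a b assume ab: "a \<in> \<Gamma>" "b \<in> \<Gamma>"
    then obtain k where k: "k \<in> \<Gamma>" "le a k" "le b k"
      using assms unfolding directed_set_def by meson
    have "{j\<in>\<Gamma>. le k j} \<subseteq> {j\<in>\<Gamma>. le a j} \<inter> {j\<in>\<Gamma>. le b j}"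
      using assms ab k unfolding directed_set_def by blast
    then show "\<exists>x\<in>\<Gamma>. principal {j\<in>\<Gamma>. le x j} \<le>
        inf (principal {j\<in>\<Gamma>. le a j}) (principal {j\<in>\<Gamma>. le b j})"
      using k(1) by auto
  qed
  then show ?thesis
    by (auto simp: eventually_principal)
qed

definition vague_tendsto ::
    "'a::metric_space set set \<Rightarrow> ('i \<Rightarrow> 'a measure) \<Rightarrow> 'a measure \<Rightarrow> 'i filter \<Rightarrow> bool" where
  "vague_tendsto \<S> \<nu> \<mu> F \<longleftrightarrow>
     (\<forall>f\<in>test_functions \<S>. ((\<lambda>\<gamma>. \<integral>x. f x \<partial>\<nu> \<gamma>) \<longlongrightarrow> (\<integral>x. f x \<partial>\<mu>)) F)"

text \<open>The normalising function \<open>g\<close> lives on the half-line, so its values at negative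
  arguments are irrelevant.\<close>

definition regularly_varying ::
    "'w measure \<Rightarrow> (real \<Rightarrow> 'a::metric_space \<Rightarrow> 'a) \<Rightarrow> 'a set set \<Rightarrow> (real \<Rightarrow> real) \<Rightarrow>
     'a measure \<Rightarrow> ('w \<Rightarrow> 'a) \<Rightarrow> bool" where
  "regularly_varying M T \<S> g \<mu> \<xi> \<longleftrightarrow>
     g \<in> borel_measurable (restrict_space borel {0..}) \<and>
     filterlim g at_top at_top \<and>
     \<mu> \<in> ideal_measures \<S> \<and> nontrivial_on \<S> \<mu> \<and>
     (\<forall>f\<in>test_functions \<S>.
        ((\<lambda>t. g t * (\<integral>\<omega>. f (T (inverse t) (\<xi> \<omega>)) \<partial>M)) \<longlongrightarrow> (\<integral>x. f x \<partial>\<mu>)) at_top)"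

end

theory Submission
  imports Defs
begin

text \<open>
  The assertion is that the measures \<open>g t * P(T (inverse t) \<xi> \<in> _)\<close> converge vaguely
  to \<open>\<mu>\<close>. For a Lipschitz test function \<open>\<phi>\<close>, with constant \<open>L\<close> and
  support \<open>A\<close>, this is a three-term estimate that passes from \<open>\<xi>\<close> to
  \<open>\<eta> \<gamma>\<close>, from there to \<open>\<integral>\<phi> d\<mu>\<^sub>\<gamma>\<close> (the regular variation of
  \<open>\<eta> \<gamma>\<close>), and from there to \<open>\<integral>\<phi> d\<mu>\<close> (the vague convergence of
  \<open>\<mu>\<^sub>\<gamma>\<close>). In the first term, where the scaled \<open>\<xi>\<close> and
  \<open>\<eta> \<gamma>\<close> are within \<open>\<delta> \<le> r\<close> of each other, the values of
  \<open>\<phi>\<close> differ by at most \<open>L * \<delta>\<close>, and they differ at all only if the scaled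
  \<open>\<xi>\<close> lies in the envelope \<open>A\<^sup>r\<close>. That set is closed and in the ideal, so its
  scaled probability stays bounded, and a small \<open>\<delta>\<close> makes this contribution small.
  The event that the distance exceeds \<open>\<delta>\<close> has small scaled probability for large \<open>t\<close>
  when \<open>\<gamma>\<close> is far enough along the net, by hypothesis. The order of
  choices is \<open>\<delta>\<close>, then \<open>\<gamma>\<close>, then \<open>t\<close>.

  A general test function is continuous but need not be uniformly continuous, so the
  estimate does not apply to it directly. The bridge is
  \<open>convergence_of_lipschitz_imp_convergence\<close>. A nonnegative continuous \<open>f\<close> is the
  pointwise limit of the Lipschitz functions \<open>x \<mapsto> inf\<^sub>y (f y + n * dist x y)\<close>, which
  lie below \<open>f\<close> and hence inherit its support; this bounds the limit inferior from below.
  For the upper bound one takes a Lipschitz cutoff \<open>h\<close> with \<open>\<bar>f\<bar> \<le> h\<close>, supported in an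
  envelope of the support of \<open>f\<close>. The lower bound holds for \<open>h + f\<close> and for
  \<open>h - f\<close>, and the integrals of \<open>h\<close> converge, so those of \<open>f\<close> are squeezed.
\<close>

section \<open>Test functions of an ideal that contains envelopes\<close>

text \<open>A point of the union is itself a member of the ideal as a singleton, and the envelopes
  of a singleton are closed balls.\<close>

lemma Union_ideal_open:
  fixes \<S> :: "'a::metric_space set set"
  assumes ideal: "set_ideal \<S>"
    and env: "\<And>A. A \<in> \<S> \<Longrightarrow> \<exists>r>0. envelope A r \<in> \<S>"
  shows "open (\<Union>\<S>)"
  unfolding open_contains_ball
proof
  fix x assume "x \<in> \<Union>\<S>"
  then obtain A where A: "A \<in> \<S>" "{x} \<subseteq> A"
    by blast
  then have "{x} \<in> \<S>"
    using ideal by (simp add: set_ideal_def)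
  then obtain r where r: "r > 0" "envelope {x} r \<in> \<S>"
    using env by blast
  have "ball x r \<subseteq> envelope {x} r"
    by (auto simp: envelope_def dist_commute)
  then show "\<exists>e>0. ball x e \<subseteq> \<Union>\<S>"
    using r by blast
qed

lemma closed_envelope: "closed (envelope A r)"
proof -
  have "closed {x. infdist x A \<le> r}"
    by (intro closed_Collect_le continuous_intros)
  then show ?thesis
    by (cases "A = {}") (auto simp: envelope_def)
qed

lemma test_functionI:
  fixes f :: "'a::metric_space \<Rightarrow> real"
  assumes ideal: "set_ideal \<S>" and B: "closed B" "B \<in> \<S>"
    and cont: "continuous_on UNIV f" and bound: "\<And>x. \<bar>f x\<bar> \<le> C"
    and supp: "\<And>x. x \<notin> B \<Longrightarrow> f x = 0"
  shows "f \<in> test_functions \<S>"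
proof -
  have "closure {x. f x \<noteq> 0} \<subseteq> B"
    by (intro closure_minimal B) (use supp in blast)
  then have "closure {x. f x \<noteq> 0} \<in> \<S>"
    using ideal B(2) unfolding set_ideal_def by blast
  moreover have "bounded (f ` \<Union>\<S>)"
    using bound by (auto simp: bounded_iff)
  moreover have "\<forall>x. x \<notin> \<Union>\<S> \<longrightarrow> f x = 0"
    using supp B(2) by blast
  ultimately show ?thesis
    using continuous_on_subset[OF cont] by (auto simp: test_functions_def)
qed

text \<open>Test functions are continuous on \<open>\<Union>\<S>\<close> by definition. The open sets \<open>\<Union>\<S>\<close>
  and the complement of the support cover the space, so the extension by zero
  creates no discontinuity on the boundary of \<open>\<Union>\<S>\<close>.\<close>

lemma test_function_continuous:
  fixes f :: "'a::metric_space \<Rightarrow> real"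
  assumes "open (\<Union>\<S>)" and f: "f \<in> test_functions \<S>"
  shows "continuous_on UNIV f"
proof -
  let ?K = "closure {x. f x \<noteq> 0}"
  have "?K \<subseteq> \<Union>\<S>"
    using f by (auto simp: test_functions_def)
  then have cover: "UNIV = \<Union>\<S> \<union> - ?K"
    by blast
  have "continuous_on (- ?K) f \<longleftrightarrow> continuous_on (- ?K) (\<lambda>_. 0 :: real)"
  proof (rule continuous_on_cong[OF refl])
    show "f x = 0" if "x \<in> - ?K" for x
      using that closure_subset[of "{x. f x \<noteq> 0}"] by blast
  qed
  then have "continuous_on (- ?K) f"
    by (simp only: continuous_on_const)
  moreover have "continuous_on (\<Union>\<S>) f"
    using f by (simp add: test_functions_def)
  ultimately have "continuous_on (\<Union>\<S> \<union> - ?K) f"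
    using assms(1) by (intro continuous_on_open_Un) auto
  then show ?thesis
    unfolding cover[symmetric] .
qed

lemma test_function_bounded:
  assumes f: "f \<in> test_functions \<S>"
  obtains C where "C > 0" "\<And>x. \<bar>f x\<bar> \<le> C"
proof -
  obtain C where C: "C > 0" "\<forall>y\<in>f ` \<Union>\<S>. norm y \<le> C"
    using f unfolding test_functions_def bounded_pos by blast
  have "\<bar>f x\<bar> \<le> C" for x
    using C f by (cases "x \<in> \<Union>\<S>") (auto simp: test_functions_def)
  with C show ?thesis
    using that by blast
qed

lemma test_function_zero_outside_support:
  "x \<notin> closure {x. f x \<noteq> 0} \<Longrightarrow> f x = 0"
  using closure_subset[of "{x. f x \<noteq> 0}"] by blast

lemma test_function_integrable:
  fixes f :: "'a::metric_space \<Rightarrow> real"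
  assumes "open (\<Union>\<S>)" and \<nu>: "\<nu> \<in> ideal_measures \<S>" and f: "f \<in> test_functions \<S>"
  shows "integrable \<nu> f"
proof -
  let ?K = "closure {x. f x \<noteq> 0}"
  obtain C where C: "\<And>x. \<bar>f x\<bar> \<le> C"
    using test_function_bounded[OF f] by blast
  have sets: "sets \<nu> = sets borel"
    using \<nu> by (simp add: ideal_measures_def)
  have "?K \<in> \<S> \<inter> sets borel"
    using f by (simp add: test_functions_def)
  then have fin: "emeasure \<nu> ?K < \<infinity>"
    using \<nu> unfolding ideal_measures_def by blast
  have "integrable \<nu> (\<lambda>x. C * indicator ?K x :: real)"
    using fin by (simp add: sets)
  moreover have "f \<in> borel_measurable \<nu>"
    using borel_measurable_continuous_onI[OF test_function_continuous[OF assms(1) f]]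
    by (simp add: measurable_cong_sets[OF sets refl])
  moreover have "\<bar>f x\<bar> \<le> \<bar>C * indicator ?K x\<bar>" for x
    using C[of x] test_function_zero_outside_support[of x f] by (auto simp: indicator_def)
  ultimately show ?thesis
    by (intro Bochner_Integration.integrable_bound[of \<nu> "\<lambda>x. C * indicator ?K x :: real" f]) auto
qed

section \<open>Lipschitz test functions determine vague limits\<close>

text \<open>The infimal convolution of \<open>f\<close> with \<open>n * dist\<close>; for nonnegative \<open>f\<close> it is the largest \<open>n\<close>-Lipschitz
  function below \<open>f\<close>.\<close>

definition lipschitz_minorant :: "('a::metric_space \<Rightarrow> real) \<Rightarrow> nat \<Rightarrow> 'a \<Rightarrow> real" where
  "lipschitz_minorant f n x = (INF y. f y + real n * dist x y)"

lemma lipschitz_minorant_bdd: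
  fixes f :: "'a::metric_space \<Rightarrow> real"
  assumes "\<And>x. 0 \<le> f x"
  shows "bdd_below (range (\<lambda>y. f y + real n * dist x y))"
  by (rule bdd_belowI[of _ 0]) (auto simp: assms)

lemma lipschitz_minorant_le:
  fixes f :: "'a::metric_space \<Rightarrow> real"
  assumes "\<And>x. 0 \<le> f x"
  shows "lipschitz_minorant f n x \<le> f y + real n * dist x y"
  unfolding lipschitz_minorant_def
  by (rule cINF_lower[OF lipschitz_minorant_bdd]) (auto simp: assms)

lemma lipschitz_minorant_between:
  fixes f :: "'a::metric_space \<Rightarrow> real"
  assumes "\<And>x. 0 \<le> f x"
  shows "0 \<le> lipschitz_minorant f n x" "lipschitz_minorant f n x \<le> f x"
proof -
  show "0 \<le> lipschitz_minorant f n x"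
    unfolding lipschitz_minorant_def by (rule cINF_greatest) (auto simp: assms)
  show "lipschitz_minorant f n x \<le> f x"
    using lipschitz_minorant_le[of f n x x] assms by simp
qed

lemma lipschitz_minorant_lipschitz:
  fixes f :: "'a::metric_space \<Rightarrow> real"
  assumes "\<And>x. 0 \<le> f x"
  shows "(real n)-lipschitz_on UNIV (lipschitz_minorant f n)"
proof -
  have bound: "lipschitz_minorant f n x \<le> lipschitz_minorant f n z + real n * dist x z" for x z
  proof -
    have "lipschitz_minorant f n x - real n * dist x z \<le> f y + real n * dist z y" for y
    proof -
      have "real n * dist x y \<le> real n * (dist x z + dist z y)"
        by (intro mult_left_mono dist_triangle) auto
      then show ?thesis
        using lipschitz_minorant_le[of f n x y] assms by (simp add: algebra_simps)
    qed
    then have "lipschitz_minorant f n x - real n * dist x z \<le> lipschitz_minorant f n z"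
      unfolding lipschitz_minorant_def[of f n z] by (intro cINF_greatest) auto
    then show ?thesis
      by simp
  qed
  have "dist (lipschitz_minorant f n x) (lipschitz_minorant f n z) \<le> real n * dist x z"
    for x z
    using bound[of x z] bound[of z x] by (simp add: dist_real_def abs_le_iff dist_commute)
  then show ?thesis
    by (intro lipschitz_onI) auto
qed

text \<open>In the infimum at \<open>x\<close>, points \<open>y\<close> near \<open>x\<close> contribute nearly \<open>f x\<close> or more by
  continuity, and once \<open>n\<close> is large, points at distance at least \<open>d\<close> contribute at least
  \<open>n * d \<ge> f x\<close> because \<open>f\<close> is nonnegative.\<close>

lemma lipschitz_minorant_tendsto:
  fixes f :: "'a::metric_space \<Rightarrow> real"
  assumes nonneg: "\<And>x. 0 \<le> f x" and cont: "continuous_on UNIV f"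
  shows "(\<lambda>n. lipschitz_minorant f n x) \<longlonglongrightarrow> f x"
proof (rule LIMSEQ_I)
  fix e :: real assume "e > 0"
  obtain d where d: "d > 0" "\<And>y. dist y x < d \<Longrightarrow> dist (f y) (f x) < e / 2"
    using cont \<open>e > 0\<close> unfolding continuous_on_iff by (metis UNIV_I half_gt_zero)
  obtain n0 :: nat where n0: "f x / d \<le> real n0"
    using real_arch_simple by blast
  have "norm (lipschitz_minorant f n x - f x) < e" if "n \<ge> n0" for n
  proof -
    have "f x - e / 2 \<le> f y + real n * dist x y" for y
    proof (cases "dist y x < d")
      case True
      then have "f x - e / 2 \<le> f y"
        using d(2)[of y] unfolding dist_real_def by linarith
      then show ?thesis
        by (simp add: add_increasing2)
    next
      case False
      have "f x \<le> real n0 * d"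
        using n0 d(1) by (simp add: field_simps)
      also have "\<dots> \<le> real n * dist x y"
        using False that d(1) by (intro mult_mono) (auto simp: dist_commute)
      finally show ?thesis
        using nonneg[of y] \<open>e > 0\<close> by linarith
    qed
    then have "f x - e / 2 \<le> lipschitz_minorant f n x"
      unfolding lipschitz_minorant_def by (intro cINF_greatest) auto
    then show ?thesis
      using lipschitz_minorant_between(2)[of f n x] nonneg \<open>e > 0\<close> by simp
  qed
  then show "\<exists>no. \<forall>n\<ge>no. norm (lipschitz_minorant f n x - f x) < e"
    by blast
qed

text \<open>The lower half of the passage from Lipschitz to continuous test functions: by dominated
  convergence some Lipschitz minorant of \<open>f\<close> already has integral above \<open>a\<close>. Its scaled
  expectations are eventually above \<open>a\<close>, and those of \<open>f\<close> are at least as large.\<close>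

lemma scaled_expectation_eventually_gt:
  fixes f :: "'a::metric_space \<Rightarrow> real" and g :: "'t \<Rightarrow> real" and X :: "'t \<Rightarrow> 'w \<Rightarrow> 'a"
  assumes ideal: "set_ideal \<S>" and U: "open (\<Union>\<S>)"
    and M: "finite_measure M" and X: "\<forall>\<^sub>F t in F. X t \<in> borel_measurable M"
    and g: "\<forall>\<^sub>F t in F. 0 \<le> g t"
    and \<mu>: "\<mu> \<in> ideal_measures \<S>"
    and lip: "\<And>\<phi> L. \<phi> \<in> test_functions \<S> \<Longrightarrow> L-lipschitz_on UNIV \<phi> \<Longrightarrow>
      ((\<lambda>t. g t * (\<integral>\<omega>. \<phi> (X t \<omega>) \<partial>M)) \<longlongrightarrow> (\<integral>x. \<phi> x \<partial>\<mu>)) F"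
    and f: "f \<in> test_functions \<S>" and nonneg: "\<And>x. 0 \<le> f x"
    and a: "a < (\<integral>x. f x \<partial>\<mu>)"
  shows "\<forall>\<^sub>F t in F. a < g t * (\<integral>\<omega>. f (X t \<omega>) \<partial>M)"
proof -
  interpret finite_measure M by fact
  let ?K = "closure {x. f x \<noteq> 0}"
  let ?f = "lipschitz_minorant f"
  have cont: "continuous_on UNIV f"
    by (rule test_function_continuous[OF U f])
  obtain C where C: "\<And>x. \<bar>f x\<bar> \<le> C"
    using test_function_bounded[OF f] by blast
  have fC: "f x \<le> C" for x
    using C[of x] by simp
  have btw: "0 \<le> ?f n x" "?f n x \<le> f x" for n x
    using lipschitz_minorant_between[of f] nonneg by auto
  have lipf: "(real n)-lipschitz_on UNIV (?f n)" for n
    by (rule lipschitz_minorant_lipschitz[OF nonneg])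
  have contn: "continuous_on UNIV (?f n)" for n
    by (rule lipschitz_on_continuous_on[OF lipf])
  have test: "?f n \<in> test_functions \<S>" for n
  proof (rule test_functionI[OF ideal _ _ contn])
    show "closed ?K" "?K \<in> \<S>"
      using f by (auto simp: test_functions_def)
    show "\<bar>?f n x\<bar> \<le> C" for x
      using btw[of n x] fC[of x] by simp
    show "?f n x = 0" if "x \<notin> ?K" for x
      using btw[of n x] test_function_zero_outside_support[OF that] by simp
  qed
  have "(\<lambda>n. \<integral>x. ?f n x \<partial>\<mu>) \<longlonglongrightarrow> (\<integral>x. f x \<partial>\<mu>)"
  proof (rule integral_dominated_convergence[where w = f])
    show intf: "integrable \<mu> f"
      by (rule test_function_integrable[OF U \<mu> f])
    show "f \<in> borel_measurable \<mu>"
      using intf by simp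
    show "?f n \<in> borel_measurable \<mu>" for n
      using test_function_integrable[OF U \<mu> test] by simp
    show "AE x in \<mu>. (\<lambda>n. ?f n x) \<longlonglongrightarrow> f x"
      using lipschitz_minorant_tendsto[OF nonneg cont] by simp
    show "AE x in \<mu>. norm (?f n x) \<le> f x" for n
      using btw by simp
  qed
  then obtain n where n: "a < (\<integral>x. ?f n x \<partial>\<mu>)"
    using a order_tendstoD(1) eventually_sequentially by (metis order_refl)
  have "\<forall>\<^sub>F t in F. a < g t * (\<integral>\<omega>. ?f n (X t \<omega>) \<partial>M)"
    using lip[OF test lipf] n by (rule order_tendstoD(1))
  then show ?thesis
    using X g
  proof eventually_elim
    case (elim t)
    have meas: "(\<lambda>\<omega>. h (X t \<omega>)) \<in> borel_measurable M"
      if "continuous_on UNIV h" for h :: "'a \<Rightarrow> real"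
      using measurable_compose[OF elim(2) borel_measurable_continuous_onI[OF that]] .
    have "(\<integral>\<omega>. ?f n (X t \<omega>) \<partial>M) \<le> (\<integral>\<omega>. f (X t \<omega>) \<partial>M)"
    proof (rule integral_mono)
      show "integrable M (\<lambda>\<omega>. ?f n (X t \<omega>))"
        by (rule integrable_const_bound[where B = C])
           (use btw order_trans[OF btw(2) fC] in \<open>auto intro!: meas contn\<close>)
      show "integrable M (\<lambda>\<omega>. f (X t \<omega>))"
        by (rule integrable_const_bound[where B = C])
           (use C in \<open>auto intro!: meas cont\<close>)
    qed (rule btw)
    then show ?case
      using elim mult_left_mono by fastforce
  qed
qed

text \<open>The measures in question have no common total mass that would let one apply the lower
  bound to \<open>C - f\<close>. A Lipschitz cutoff \<open>h\<close> replaces the constant: it equals the bound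
  \<open>C\<close> on the support of \<open>f\<close> and vanishes outside an envelope of it that is still in the
  ideal.\<close>

lemma convergence_of_lipschitz_imp_convergence:
  fixes f :: "'a::metric_space \<Rightarrow> real" and g :: "'t \<Rightarrow> real" and X :: "'t \<Rightarrow> 'w \<Rightarrow> 'a"
  assumes ideal: "set_ideal \<S>"
    and env: "\<And>A. A \<in> \<S> \<Longrightarrow> \<exists>r>0. envelope A r \<in> \<S>"
    and M: "finite_measure M" and X: "\<forall>\<^sub>F t in F. X t \<in> borel_measurable M"
    and g: "\<forall>\<^sub>F t in F. 0 \<le> g t"
    and \<mu>: "\<mu> \<in> ideal_measures \<S>"
    and lip: "\<And>\<phi> L. \<phi> \<in> test_functions \<S> \<Longrightarrow> L-lipschitz_on UNIV \<phi> \<Longrightarrow>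
      ((\<lambda>t. g t * (\<integral>\<omega>. \<phi> (X t \<omega>) \<partial>M)) \<longlongrightarrow> (\<integral>x. \<phi> x \<partial>\<mu>)) F"
    and f: "f \<in> test_functions \<S>"
  shows "((\<lambda>t. g t * (\<integral>\<omega>. f (X t \<omega>) \<partial>M)) \<longlongrightarrow> (\<integral>x. f x \<partial>\<mu>)) F"
proof (cases "\<forall>x. f x = 0")
  case True
  then show ?thesis
    by simp
next
  case False
  interpret finite_measure M by fact
  let ?K = "closure {x. f x \<noteq> 0}"
  have U: "open (\<Union>\<S>)"
    by (rule Union_ideal_open[OF ideal env])
  have K: "?K \<noteq> {}" "?K \<in> \<S>"
    using False f by (auto simp: test_functions_def)
  then obtain r where r: "r > 0" "envelope ?K r \<in> \<S>"
    using env by blast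
  obtain C where C: "C > 0" "\<And>x. \<bar>f x\<bar> \<le> C"
    using test_function_bounded[OF f] by blast
  define h where "h x = C * max 0 (1 - infdist x ?K / r)" for x
  have h: "0 \<le> h x" "h x \<le> C" "x \<in> ?K \<Longrightarrow> h x = C" "x \<notin> envelope ?K r \<Longrightarrow> h x = 0" for x
    using C(1) r(1) K(1) infdist_nonneg[of x ?K]
    by (auto simp: h_def envelope_def mult_le_cancel_left1 field_simps max_def)
  have hf: "\<bar>f x\<bar> \<le> h x" for x
    using C(2)[of x] h(1)[of x] h(3)[of x] test_function_zero_outside_support[of x f]
    by (cases "x \<in> ?K") auto
  have cont: "continuous_on UNIV f"
    by (rule test_function_continuous[OF U f])
  have hlip: "(C / r)-lipschitz_on UNIV h"
  proof (rule lipschitz_onI)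
    fix x y
    have "\<bar>infdist x ?K - infdist y ?K\<bar> \<le> dist x y"
      using infdist_triangle[of x ?K y] infdist_triangle[of y ?K x] by (simp add: dist_commute)
    then have d: "\<bar>infdist x ?K / r - infdist y ?K / r\<bar> \<le> dist x y / r"
      using r(1) by (simp add: field_simps flip: diff_divide_distrib)
    have "\<bar>max 0 (1 - infdist x ?K / r) - max 0 (1 - infdist y ?K / r)\<bar> \<le> dist x y / r"
      using d by linarith
    then have "C * \<bar>max 0 (1 - infdist x ?K / r) - max 0 (1 - infdist y ?K / r)\<bar> \<le> C * (dist x y / r)"
      using C(1) by (intro mult_left_mono) auto
    then show "dist (h x) (h y) \<le> C / r * dist x y"
      using C(1) by (simp add: h_def dist_real_def abs_mult flip: right_diff_distrib)
  qed (use C r in auto)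
  have hcont: "continuous_on UNIV h"
    by (rule lipschitz_on_continuous_on[OF hlip])
  have test: "k \<in> test_functions \<S>"
    if "continuous_on UNIV k" "\<And>x. \<bar>k x\<bar> \<le> 2 * h x" for k :: "'a \<Rightarrow> real"
  proof (rule test_functionI[OF ideal closed_envelope r(2) that(1)])
    show "\<bar>k x\<bar> \<le> 2 * C" for x
      using that(2)[of x] h(2)[of x] by simp
    show "k x = 0" if "x \<notin> envelope ?K r" for x
      using \<open>\<bar>k x\<bar> \<le> 2 * h x\<close> h(4)[OF that] by simp
  qed
  have th: "h \<in> test_functions \<S>"
    by (rule test[OF hcont]) (use h(1) in auto)
  have tp: "(\<lambda>x. h x + f x) \<in> test_functions \<S>"
  proof (rule test)
    show "\<bar>h x + f x\<bar> \<le> 2 * h x" for x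
      using hf[of x] by linarith
  qed (intro continuous_intros hcont cont)
  have tm: "(\<lambda>x. h x - f x) \<in> test_functions \<S>"
  proof (rule test)
    show "\<bar>h x - f x\<bar> \<le> 2 * h x" for x
      using hf[of x] by linarith
  qed (intro continuous_intros hcont cont)
  have int: "integrable \<mu> h" "integrable \<mu> f"
    using test_function_integrable[OF U \<mu>] th f by auto
  have limh: "((\<lambda>t. g t * (\<integral>\<omega>. h (X t \<omega>) \<partial>M)) \<longlongrightarrow> (\<integral>x. h x \<partial>\<mu>)) F"
    by (rule lip[OF th hlip])
  have intX: "integrable M (\<lambda>\<omega>. k (X t \<omega>))"
    if "X t \<in> borel_measurable M" "k \<in> test_functions \<S>" for t k
  proof -
    obtain B where "\<And>x. \<bar>k x\<bar> \<le> B"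
      using test_function_bounded[OF \<open>k \<in> _\<close>] by blast
    then show ?thesis
      using measurable_compose[OF that(1) borel_measurable_continuous_onI
          [OF test_function_continuous[OF U that(2)]]]
      by (intro integrable_const_bound[where B = B]) auto
  qed
  show ?thesis
  proof (rule tendstoI)
    fix e :: real assume "e > 0"
    have up: "\<forall>\<^sub>F t in F. (\<integral>x. h x + f x \<partial>\<mu>) - e / 2 < g t * (\<integral>\<omega>. h (X t \<omega>) + f (X t \<omega>) \<partial>M)"
    proof (rule scaled_expectation_eventually_gt[OF ideal U M X g \<mu> lip tp])
      show "0 \<le> h x + f x" for x
        using hf[of x] by linarith
    qed (use \<open>e > 0\<close> in auto)
    have lo: "\<forall>\<^sub>F t in F. (\<integral>x. h x - f x \<partial>\<mu>) - e / 2 < g t * (\<integral>\<omega>. h (X t \<omega>) - f (X t \<omega>) \<partial>M)"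
    proof (rule scaled_expectation_eventually_gt[OF ideal U M X g \<mu> lip tm])
      show "0 \<le> h x - f x" for x
        using hf[of x] by linarith
    qed (use \<open>e > 0\<close> in auto)
    \<comment> \<open>Subtracting this from the two lower bounds isolates \<open>f\<close> from above and from below.\<close>
    have "\<forall>\<^sub>F t in F. dist (g t * (\<integral>\<omega>. h (X t \<omega>) \<partial>M)) (\<integral>x. h x \<partial>\<mu>) < e / 2"
      using limh \<open>e > 0\<close> by (intro tendstoD) auto
    with up lo X
    show "\<forall>\<^sub>F t in F. dist (g t * (\<integral>\<omega>. f (X t \<omega>) \<partial>M)) (\<integral>x. f x \<partial>\<mu>) < e"
    proof eventually_elim
      case (elim t)
      note iX = intX[OF elim(3) th] intX[OF elim(3) f]
      let ?a = "g t * (\<integral>\<omega>. h (X t \<omega>) \<partial>M)" and ?b = "g t * (\<integral>\<omega>. f (X t \<omega>) \<partial>M)"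
      have "(\<integral>x. h x \<partial>\<mu>) + (\<integral>x. f x \<partial>\<mu>) - e / 2 < ?a + ?b"
        "(\<integral>x. h x \<partial>\<mu>) - (\<integral>x. f x \<partial>\<mu>) - e / 2 < ?a - ?b"
        using elim(1,2) by (simp_all add: int iX ring_distribs)
      moreover have "\<bar>?a - (\<integral>x. h x \<partial>\<mu>)\<bar> < e / 2"
        using elim(4) by (simp add: dist_real_def)
      ultimately have "\<bar>?b - (\<integral>x. f x \<partial>\<mu>)\<bar> < e"
        by argo
      then show ?case
        by (simp add: dist_real_def)
    qed
  qed
qed

section \<open>Comparison of two random elements\<close>

text \<open>Where \<open>Y\<close> and \<open>Z\<close> are \<open>\<delta>\<close>-close, the Lipschitz bound applies, and a nonzero difference
  forces one of them into \<open>A\<close>, so that \<open>Y\<close> lies in the envelope of \<open>A\<close>. The envelope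
  is placed on \<open>Y\<close> alone, whose scaled probabilities are the ones bounded in the
  application. Elsewhere the trivial bound \<open>2 * C\<close> remains.\<close>

lemma expectation_lipschitz_difference:
  fixes \<phi> :: "'a::metric_space \<Rightarrow> real"
  assumes M: "finite_measure M"
    and Y: "Y \<in> borel_measurable M" and Z: "Z \<in> borel_measurable M"
    and far: "{\<omega> \<in> space M. dist (Y \<omega>) (Z \<omega>) > \<delta>} \<in> sets M"
    and lip: "L-lipschitz_on UNIV \<phi>" and C: "\<And>x. \<bar>\<phi> x\<bar> \<le> C"
    and supp: "\<And>x. \<phi> x \<noteq> 0 \<Longrightarrow> x \<in> A" and \<delta>: "0 < \<delta>" "\<delta> \<le> r"
  shows "\<bar>(\<integral>\<omega>. \<phi> (Y \<omega>) \<partial>M) - (\<integral>\<omega>. \<phi> (Z \<omega>) \<partial>M)\<bar> \<le>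
    L * \<delta> * measure M {\<omega> \<in> space M. Y \<omega> \<in> envelope A r} +
    2 * C * measure M {\<omega> \<in> space M. dist (Y \<omega>) (Z \<omega>) > \<delta>}"
proof -
  interpret finite_measure M by fact
  let ?N = "{\<omega> \<in> space M. Y \<omega> \<in> envelope A r}"
  let ?D = "{\<omega> \<in> space M. dist (Y \<omega>) (Z \<omega>) > \<delta>}"
  have L: "L \<ge> 0"
    by (rule lipschitz_on_nonneg[OF lip])
  have C0: "C \<ge> 0"
    using C[of undefined] by linarith
  have near: "?N \<in> sets M"
    using measurable_sets[OF Y, of "envelope A r"] closed_envelope[of A r]
    by (simp add: vimage_def Int_def conj_commute)
  have meas: "(\<lambda>\<omega>. \<phi> (V \<omega>)) \<in> borel_measurable M" if "V \<in> borel_measurable M" for V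
    using measurable_compose[OF that borel_measurable_continuous_onI
        [OF lipschitz_on_continuous_on[OF lip]]] .
  have intg: "integrable M (\<lambda>\<omega>. \<phi> (V \<omega>))" if "V \<in> borel_measurable M" for V
    using C meas[OF that] by (intro integrable_const_bound[where B = C]) auto
  have ptw: "\<bar>\<phi> (Y \<omega>) - \<phi> (Z \<omega>)\<bar> \<le> L * \<delta> * indicator ?N \<omega> + 2 * C * indicator ?D \<omega>"
    if \<omega>: "\<omega> \<in> space M" for \<omega>
  proof (cases "dist (Y \<omega>) (Z \<omega>) > \<delta>")
    case True
    have "0 \<le> L * \<delta> * indicator ?N \<omega>"
      using L \<delta> by simp
    then show ?thesis
      using True \<omega> C[of "Y \<omega>"] C[of "Z \<omega>"] by simp
  next
    case False
    show ?thesis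
    proof (cases "\<phi> (Y \<omega>) = 0 \<and> \<phi> (Z \<omega>) = 0")
      case True
      then show ?thesis
        using L \<delta> C0 by simp
    next
      case nz: False
      have "infdist (Y \<omega>) A \<le> r \<and> A \<noteq> {}"
      proof (cases "\<phi> (Y \<omega>) = 0")
        case True
        then have "Z \<omega> \<in> A"
          using nz supp by blast
        then show ?thesis
          using infdist_le[of "Z \<omega>" A "Y \<omega>"] False \<delta> by auto
      next
        case False
        then show ?thesis
          using supp \<delta> by fastforce
      qed
      then have "\<omega> \<in> ?N"
        using \<omega> by (simp add: envelope_def)
      moreover have "\<bar>\<phi> (Y \<omega>) - \<phi> (Z \<omega>)\<bar> \<le> L * \<delta>"
      proof -
        have "\<bar>\<phi> (Y \<omega>) - \<phi> (Z \<omega>)\<bar> \<le> L * dist (Y \<omega>) (Z \<omega>)"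
          using lipschitz_onD[OF lip, of "Y \<omega>" "Z \<omega>"] by (simp add: dist_real_def)
        also have "\<dots> \<le> L * \<delta>"
          using False L by (intro mult_left_mono) auto
        finally show ?thesis .
      qed
      ultimately show ?thesis
        using C0 by (simp add: add_increasing2)
    qed
  qed
  have "\<bar>(\<integral>\<omega>. \<phi> (Y \<omega>) \<partial>M) - (\<integral>\<omega>. \<phi> (Z \<omega>) \<partial>M)\<bar> = \<bar>\<integral>\<omega>. \<phi> (Y \<omega>) - \<phi> (Z \<omega>) \<partial>M\<bar>"
    by (simp add: intg Y Z)
  also have "\<dots> \<le> (\<integral>\<omega>. \<bar>\<phi> (Y \<omega>) - \<phi> (Z \<omega>)\<bar> \<partial>M)"
    by (rule integral_abs_bound)
  also have "\<dots> \<le> (\<integral>\<omega>. L * \<delta> * indicator ?N \<omega> + 2 * C * indicator ?D \<omega> \<partial>M)"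
    by (intro integral_mono ptw) (use near far in \<open>auto intro!: integrable_abs intg Y Z
        Bochner_Integration.integrable_diff simp: less_top[symmetric]\<close>)
  also have "\<dots> = L * \<delta> * measure M ?N + 2 * C * measure M ?D"
    using near far by (simp add: less_top[symmetric])
  finally show ?thesis .
qed

text \<open>In a nonseparable space the Borel sets of a product can exceed the product of the Borel
  sets. The section \<open>x \<mapsto> (x, s)\<close> is nevertheless Borel, being continuous, and this turns
  joint measurability into measurability of each \<open>T s\<close>.\<close>

lemma scaling_measurable:
  assumes T: "scaling T" and s: "s > 0" and X: "X \<in> borel_measurable M"
  shows "(\<lambda>\<omega>. T s (X \<omega>)) \<in> borel_measurable M"
proof -
  have pair: "(\<lambda>x. (x, s)) \<in> borel \<rightarrow>\<^sub>M restrict_space borel (UNIV \<times> {0<..})"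
    using s by (intro measurable_restrict_space2 borel_measurable_continuous_onI continuous_intros) auto
  have "(\<lambda>(x, t). T t x) \<in> borel_measurable (restrict_space borel (UNIV \<times> {0<..}))"
    using T by (simp add: scaling_def)
  from measurable_compose[OF X measurable_compose[OF pair this]] show ?thesis
    by simp
qed

lemma eventually_net_filterD:
  assumes "directed_set \<Gamma> le" and "eventually P (net_filter \<Gamma> le)"
  obtains \<gamma> where "\<gamma> \<in> \<Gamma>" "P \<gamma>"
  using assms(2) that unfolding eventually_net_filter[OF assms(1)]
  using assms(1) unfolding directed_set_def by blast

section \<open>Approximation of regularly varying elements\<close>

theorem theorem3p7p2:
  fixes T :: "real \<Rightarrow> 'a::metric_space \<Rightarrow> 'a"
    and \<S> :: "'a set set"
    and M :: "'w measure"
    and \<xi> :: "'w \<Rightarrow> 'a"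
    and \<Gamma> :: "'i set" and le :: "'i \<Rightarrow> 'i \<Rightarrow> bool"
    and \<eta> :: "'i \<Rightarrow> 'w \<Rightarrow> 'a"
    and g :: "real \<Rightarrow> real"
    and \<mu> :: "'a measure" and \<mu>s :: "'i \<Rightarrow> 'a measure"
  assumes "scaling T"
    and "set_ideal \<S>"
    and "scaling_consistent T \<S>"
    and "\<And>A. A \<in> \<S> \<Longrightarrow> \<exists>r>0. envelope A r \<in> \<S>"
    and "prob_space M"
    and "\<xi> \<in> borel_measurable M"
    and "directed_set \<Gamma> le"
    and "\<And>\<gamma>. \<gamma> \<in> \<Gamma> \<Longrightarrow> \<eta> \<gamma> \<in> borel_measurable M"
    and "\<And>t. t \<ge> 0 \<Longrightarrow> g t \<ge> 0"
    and "g \<in> borel_measurable (restrict_space borel {0..})"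
    and "\<mu> \<in> ideal_measures \<S>"
    and "nontrivial_on \<S> \<mu>"
    and "\<And>\<gamma>. \<gamma> \<in> \<Gamma> \<Longrightarrow> \<mu>s \<gamma> \<in> ideal_measures \<S>"
    and i: "\<And>\<gamma>. \<gamma> \<in> \<Gamma> \<Longrightarrow> regularly_varying M T \<S> g (\<mu>s \<gamma>) (\<eta> \<gamma>)"
    and ii: "vague_tendsto \<S> \<mu>s \<mu> (net_filter \<Gamma> le)"
    and iii: "\<And>A. closed A \<Longrightarrow> A \<in> \<S> \<Longrightarrow>
      Limsup at_top (\<lambda>t. ereal (g t * \<P>(\<omega> in M. T (inverse t) (\<xi> \<omega>) \<in> A))) < \<infinity>"
    and iv_events: "\<And>\<delta> \<gamma> t. \<delta> > 0 \<Longrightarrow> \<gamma> \<in> \<Gamma> \<Longrightarrow> t > 0 \<Longrightarrow>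
      {\<omega> \<in> space M. dist (T (inverse t) (\<xi> \<omega>)) (T (inverse t) (\<eta> \<gamma> \<omega>)) > \<delta>} \<in> sets M"
    and iv: "\<And>\<delta>. \<delta> > 0 \<Longrightarrow>
      ((\<lambda>\<gamma>. Limsup at_top (\<lambda>t. ereal (g t *
          \<P>(\<omega> in M. dist (T (inverse t) (\<xi> \<omega>)) (T (inverse t) (\<eta> \<gamma> \<omega>)) > \<delta>))))
        \<longlongrightarrow> 0) (net_filter \<Gamma> le)"
  shows "regularly_varying M T \<S> g \<mu> \<xi>"
proof -
  interpret prob_space M by fact
  have fm: "finite_measure M"
    by unfold_locales
  have U: "open (\<Union>\<S>)"
    by (rule Union_ideal_open[OF assms(2) assms(4)])
  have meas: "(\<lambda>\<omega>. T (inverse t) (X \<omega>)) \<in> borel_measurable M"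
    if "t > 0" "X \<in> borel_measurable M" for t X
    using scaling_measurable[OF assms(1) _ that(2)] that(1) by simp
  have ev0: "\<forall>\<^sub>F t::real in at_top. t > 0"
    by (rule eventually_gt_at_top)
  have lipschitz_case: "((\<lambda>t. g t * (\<integral>\<omega>. \<phi> (T (inverse t) (\<xi> \<omega>)) \<partial>M)) \<longlongrightarrow> (\<integral>x. \<phi> x \<partial>\<mu>)) at_top"
    if \<phi>: "\<phi> \<in> test_functions \<S>" and lip: "L-lipschitz_on UNIV \<phi>" for \<phi> L
  proof (rule tendstoI)
    fix e :: real assume "e > 0"
    let ?A = "closure {x. \<phi> x \<noteq> 0}"
    have "?A \<in> \<S>"
      using \<phi> by (simp add: test_functions_def)
    then obtain r where r: "r > 0" "envelope ?A r \<in> \<S>"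
      using assms(4) by blast
    obtain C where C: "C > 0" "\<And>x. \<bar>\<phi> x\<bar> \<le> C"
      using test_function_bounded[OF \<phi>] by blast
    have L: "L \<ge> 0"
      by (rule lipschitz_on_nonneg[OF lip])
    let ?N = "\<lambda>t. \<P>(\<omega> in M. T (inverse t) (\<xi> \<omega>) \<in> envelope ?A r)"
    have "Limsup at_top (\<lambda>t. ereal (g t * ?N t)) < \<infinity>"
      by (rule iii[OF closed_envelope r(2)])
    then obtain K where "Limsup at_top (\<lambda>t. ereal (g t * ?N t)) < ereal K"
      using ereal_dense2 by blast
    then have "\<forall>\<^sub>F t in at_top. ereal (g t * ?N t) < ereal K"
      by (rule Limsup_lessD)
    then have N: "\<forall>\<^sub>F t in at_top. g t * ?N t \<le> \<bar>K\<bar> + 1"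
      by eventually_elim auto
    \<comment> \<open>\<open>c\<close> bounds \<open>L\<close> times the scaled probability of the envelope; the summand 1 keeps
      it positive when \<open>L = 0\<close>. With it, the close part costs at most \<open>e / 4\<close>.\<close>
    define c where "c = L * (\<bar>K\<bar> + 1) + 1"
    have c: "c > 0" "L * (\<bar>K\<bar> + 1) \<le> c"
      using L by (auto simp: c_def add_nonneg_pos)
    define \<delta> where "\<delta> = min r (e / (4 * c))"
    have \<delta>: "0 < \<delta>" "\<delta> \<le> r" "\<delta> * c \<le> e / 4"
    proof -
      show "0 < \<delta>" "\<delta> \<le> r"
        using r(1) c(1) \<open>e > 0\<close> by (auto simp: \<delta>_def)
      have "\<delta> * c \<le> e / (4 * c) * c"
        using c(1) by (intro mult_right_mono) (auto simp: \<delta>_def)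
      then show "\<delta> * c \<le> e / 4"
        using c(1) by simp
    qed
    let ?D = "\<lambda>\<gamma> t. \<P>(\<omega> in M. dist (T (inverse t) (\<xi> \<omega>)) (T (inverse t) (\<eta> \<gamma> \<omega>)) > \<delta>)"
    \<comment> \<open>The far part costs \<open>2 * C\<close> times the scaled probability, hence also at most \<open>e / 4\<close>.\<close>
    have "\<forall>\<^sub>F \<gamma> in net_filter \<Gamma> le.
        Limsup at_top (\<lambda>t. ereal (g t * ?D \<gamma> t)) < ereal (e / (8 * C))"
      using iv[OF \<delta>(1)] \<open>e > 0\<close> C(1) by (intro order_tendstoD(2)) auto
    moreover have "\<forall>\<^sub>F \<gamma> in net_filter \<Gamma> le. dist (\<integral>x. \<phi> x \<partial>\<mu>s \<gamma>) (\<integral>x. \<phi> x \<partial>\<mu>) < e / 4"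
      using ii \<phi> \<open>e > 0\<close> unfolding vague_tendsto_def by (intro tendstoD) auto
    ultimately have "\<forall>\<^sub>F \<gamma> in net_filter \<Gamma> le.
        Limsup at_top (\<lambda>t. ereal (g t * ?D \<gamma> t)) < ereal (e / (8 * C)) \<and>
        dist (\<integral>x. \<phi> x \<partial>\<mu>s \<gamma>) (\<integral>x. \<phi> x \<partial>\<mu>) < e / 4"
      by (rule eventually_conj)
    then obtain \<gamma> where \<gamma>: "\<gamma> \<in> \<Gamma>"
      "Limsup at_top (\<lambda>t. ereal (g t * ?D \<gamma> t)) < ereal (e / (8 * C))"
      "dist (\<integral>x. \<phi> x \<partial>\<mu>s \<gamma>) (\<integral>x. \<phi> x \<partial>\<mu>) < e / 4"
      using eventually_net_filterD[OF assms(7)] by blast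
    have D: "\<forall>\<^sub>F t in at_top. ereal (g t * ?D \<gamma> t) < ereal (e / (8 * C))"
      by (rule Limsup_lessD[OF \<gamma>(2)])
    have "((\<lambda>t. g t * (\<integral>\<omega>. \<phi> (T (inverse t) (\<eta> \<gamma> \<omega>)) \<partial>M)) \<longlongrightarrow> (\<integral>x. \<phi> x \<partial>\<mu>s \<gamma>)) at_top"
      using i[OF \<gamma>(1)] \<phi> unfolding regularly_varying_def by blast
    then have "\<forall>\<^sub>F t in at_top.
        dist (g t * (\<integral>\<omega>. \<phi> (T (inverse t) (\<eta> \<gamma> \<omega>)) \<partial>M)) (\<integral>x. \<phi> x \<partial>\<mu>s \<gamma>) < e / 4"
      using \<open>e > 0\<close> by (intro tendstoD) auto
    with N D ev0
    show "\<forall>\<^sub>F t in at_top. dist (g t * (\<integral>\<omega>. \<phi> (T (inverse t) (\<xi> \<omega>)) \<partial>M)) (\<integral>x. \<phi> x \<partial>\<mu>) < e"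
    proof eventually_elim
      case (elim t)
      let ?x = "\<integral>\<omega>. \<phi> (T (inverse t) (\<xi> \<omega>)) \<partial>M"
      let ?y = "\<integral>\<omega>. \<phi> (T (inverse t) (\<eta> \<gamma> \<omega>)) \<partial>M"
      have gt: "g t \<ge> 0"
        using assms(9) elim(3) by simp
      have supp: "x \<in> ?A" if "\<phi> x \<noteq> 0" for x
        using that test_function_zero_outside_support by blast
      have "\<bar>?x - ?y\<bar> \<le> L * \<delta> * ?N t + 2 * C * ?D \<gamma> t"
        by (rule expectation_lipschitz_difference[OF fm _ _ _ lip C(2) supp \<delta>(1,2)])
          (use elim(3) meas assms(6) assms(8)[OF \<gamma>(1)] iv_events[OF \<delta>(1) \<gamma>(1)] in auto)
      then have "g t * \<bar>?x - ?y\<bar> \<le> g t * (L * \<delta> * ?N t + 2 * C * ?D \<gamma> t)"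
        using gt by (rule mult_left_mono)
      also have "\<dots> = \<delta> * (L * (g t * ?N t)) + 2 * C * (g t * ?D \<gamma> t)"
        by (simp add: algebra_simps)
      also have "\<dots> \<le> \<delta> * c + 2 * C * (e / (8 * C))"
      proof (intro add_mono mult_left_mono)
        have "L * (g t * ?N t) \<le> L * (\<bar>K\<bar> + 1)"
          using elim(1) L by (rule mult_left_mono)
        then show "L * (g t * ?N t) \<le> c"
          using c(2) by linarith
      qed (use elim(2) C \<delta> in auto)
      also have "\<dots> \<le> e / 2"
        using \<delta>(3) C(1) by simp
      finally have "\<bar>g t * ?x - g t * ?y\<bar> \<le> e / 2"
        using gt by (simp add: abs_mult flip: right_diff_distrib)
      then show ?case
        using elim(4) \<gamma>(3) unfolding dist_real_def by linarith
    qed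
  qed
  have "((\<lambda>t. g t * (\<integral>\<omega>. f (T (inverse t) (\<xi> \<omega>)) \<partial>M)) \<longlongrightarrow> (\<integral>x. f x \<partial>\<mu>)) at_top"
    if f: "f \<in> test_functions \<S>" for f
  proof (rule convergence_of_lipschitz_imp_convergence
      [OF assms(2) assms(4) fm _ _ assms(11) lipschitz_case f])
    show "\<forall>\<^sub>F t in at_top. (\<lambda>\<omega>. T (inverse t) (\<xi> \<omega>)) \<in> borel_measurable M"
      using ev0 by eventually_elim (rule meas[OF _ assms(6)])
    show "\<forall>\<^sub>F t in at_top. 0 \<le> g t"
      using ev0 by eventually_elim (use assms(9) in auto)
  qed
  moreover have "filterlim g at_top at_top"
  proof -
    obtain \<gamma> where "\<gamma> \<in> \<Gamma>"
      using assms(7) unfolding directed_set_def by blast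
    then show ?thesis
      using i unfolding regularly_varying_def by blast
  qed
  ultimately show ?thesis
    using assms(10-12) unfolding regularly_varying_def by blast
qed

end
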